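(* Let $\mathcal{H}$ be a complex Hilbert space and let $A\in\mathcal{B}(\mathcal{H})$. Then for all $\lambda\in[0,1]$, \[\begin{aligned} \omega(A)&\le\lambda\,\omega_{\frac{\lambda}{2}}(A)+(1-\lambda)\,\omega_{\frac{1+\lambda}{2}}(A)\\ &\le\int_0^1\omega_t(A)\,dt\\ &\le\frac12\,\omega_\lambda(A)+\lambda\left\|\mathfrak{R}A\right\|+(1-\lambda)\left\|\mathfrak{I}A\right\|\\ &\le\left\|\mathfrak{R}A\right\|+\left\|\mathfrak{I}A\right\|. \end{aligned}\]
   Context: $\mathcal{B}(\mathcal{H})$ is the $C^*$-algebra of bounded linear operators on the complex Hilbert space $\mathcal{H}$, with operator norm $\|\cdot\|$. $\mathfrak{R}A=\frac{A+A^*}{2}$ and $\mathfrak{I}A=\frac{A-A^*}{2\mathrm{i}}$. The numerical radius is $\omega(A)=\sup_{\|x\|=1}|\langle Ax,x\rangle|$. For $0\le t\le 1$, the $t$-weighted numerical radius of $A$ is $\omega_t(A)=\omega\left((1-2t)A^*+A\right)$. *)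

theory Defs
  imports "HOL-Analysis.Analysis"
begin

text \<open>
  Complex inner product spaces as a type class on top of the real normed spaces of the library.
  The inner product is linear in its \<^emph>\<open>first\<close> argument. Positive definiteness of the inner
  product is contained in the axiom \<open>cinner_self\<close>, which identifies \<open>\<langle>x, x\<rangle>\<close> with \<open>\<parallel>x\<parallel>\<^sup>2\<close>.
\<close>

class complex_inner = real_normed_vector +
  fixes scaleC :: "complex \<Rightarrow> 'a \<Rightarrow> 'a" (infixr \<open>*\<^sub>C\<close> 75)
    and cinner :: "'a \<Rightarrow> 'a \<Rightarrow> complex"
  assumes scaleC_add_right: "c *\<^sub>C (x + y) = c *\<^sub>C x + c *\<^sub>C y"
    and scaleC_add_left: "(c + d) *\<^sub>C x = c *\<^sub>C x + d *\<^sub>C x"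
    and scaleC_scaleC: "c *\<^sub>C d *\<^sub>C x = (c * d) *\<^sub>C x"
    and scaleC_of_real: "complex_of_real r *\<^sub>C x = r *\<^sub>R x"
    and cinner_commute: "cinner x y = cnj (cinner y x)"
    and cinner_add_left: "cinner (x + y) z = cinner x z + cinner y z"
    and cinner_scaleC_left: "cinner (c *\<^sub>C x) y = c * cinner x y"
    and cinner_self: "cinner x x = complex_of_real ((norm x)\<^sup>2)"

class complex_hilbert_space = complex_inner + complete_space

text \<open>The complex numbers witness that the class is inhabited.\<close>

instantiation complex :: complex_hilbert_space
begin

definition scaleC_complex :: "complex \<Rightarrow> complex \<Rightarrow> complex" where
  "scaleC_complex c x = c * x"

definition cinner_complex :: "complex \<Rightarrow> complex \<Rightarrow> complex" where
  "cinner_complex x y = x * cnj y"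

instance
  by standard
    (simp_all add: scaleC_complex_def cinner_complex_def algebra_simps scaleR_conv_of_real
      complex_norm_square del: of_real_power)

end

definition bounded_clinear :: "('a::complex_inner \<Rightarrow> 'a) \<Rightarrow> bool" where
  "bounded_clinear A \<longleftrightarrow> bounded_linear A \<and> (\<forall>c x. A (c *\<^sub>C x) = c *\<^sub>C A x)"

text \<open>
  The Hilbert space adjoint, meaningful for a bounded operator on a Hilbert space: uniqueness is
  immediate from positive definiteness, existence is the Riesz representation theorem. (The
  library's \<open>adjoint\<close> refers to a real inner product.)
\<close>

definition cadjoint :: "('a::complex_hilbert_space \<Rightarrow> 'a) \<Rightarrow> 'a \<Rightarrow> 'a" where
  "cadjoint A = (THE B. \<forall>x y. cinner (A x) y = cinner x (B y))"

definition re_part :: "('a::complex_hilbert_space \<Rightarrow> 'a) \<Rightarrow> 'a \<Rightarrow> 'a" where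
  "re_part A = (\<lambda>x. (1 / 2) *\<^sub>C (A x + cadjoint A x))"

definition im_part :: "('a::complex_hilbert_space \<Rightarrow> 'a) \<Rightarrow> 'a \<Rightarrow> 'a" where
  "im_part A = (\<lambda>x. (1 / (2 * \<i>)) *\<^sub>C (A x - cadjoint A x))"

text \<open>
  The supremum is taken in \<open>[0, \<infinity>)\<close>. Inserting \<open>0\<close> only matters for the zero space, which has no
  unit vectors and where \<open>Sup {}\<close> is an unspecified real number.
\<close>

definition numerical_radius :: "('a::complex_inner \<Rightarrow> 'a) \<Rightarrow> real" where
  "numerical_radius A = Sup (insert 0 {cmod (cinner (A x) x) | x. norm x = 1})"

definition weighted_numerical_radius :: "real \<Rightarrow> ('a::complex_hilbert_space \<Rightarrow> 'a) \<Rightarrow> real" where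
  "weighted_numerical_radius t A =
     numerical_radius (\<lambda>x. (1 - 2 * t) *\<^sub>R cadjoint A x + A x)"

end

theory Submission imports Defs begin

text \<open>
  The function \<open>t \<mapsto> \<omega>\<^sub>t(A)\<close> is a supremum of moduli of affine functions of \<open>t\<close>, hence convex, and
  \<open>\<omega>\<^bsub>1/2\<^esub>(A) = \<omega>(A)\<close>, \<open>\<omega>\<^sub>0(A) \<le> 2\<parallel>\<RR>A\<parallel>\<close>, \<open>\<omega>\<^sub>1(A) \<le> 2\<parallel>\<II>A\<parallel>\<close>. The first and last inequalities are
  convexity, the first one because \<open>1/2 = \<lambda>(\<lambda>/2) + (1 - \<lambda>)(1 + \<lambda>)/2\<close>; the middle ones are the
  Hermite--Hadamard inequalities on \<open>[0, \<lambda>]\<close> and \<open>[\<lambda>, 1]\<close>.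
\<close>

section \<open>Inner product calculus and the Cauchy-Schwarz inequality\<close>

lemma cinner_add_right: "cinner x (y + z) = cinner x y + cinner x (z::'a::complex_inner)"
  by (metis cinner_add_left cinner_commute complex_cnj_add)

lemma cinner_scaleC_right: "cinner x (c *\<^sub>C y) = cnj c * cinner x (y::'a::complex_inner)"
  by (metis cinner_scaleC_left cinner_commute complex_cnj_mult)

lemma cinner_scaleR_left: "cinner (r *\<^sub>R x) y = of_real r * cinner x (y::'a::complex_inner)"
  by (metis cinner_scaleC_left scaleC_of_real)

lemma cinner_scaleR_right: "cinner x (r *\<^sub>R y) = of_real r * cinner x (y::'a::complex_inner)"
  by (metis cinner_scaleC_right scaleC_of_real complex_cnj_complex_of_real)

lemma cinner_diff_right: "cinner x (y - z) = cinner x y - cinner x (z::'a::complex_inner)"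
  by (metis cinner_add_right diff_add_cancel eq_diff_eq)

lemma norm_add_sq: "(norm (x + y))\<^sup>2 = (norm x)\<^sup>2 + 2 * Re (cinner x y) + (norm (y::'a::complex_inner))\<^sup>2"
proof -
  have "complex_of_real ((norm (x + y))\<^sup>2)
      = of_real ((norm x)\<^sup>2) + (cinner x y + cnj (cinner x y)) + of_real ((norm y)\<^sup>2)"
    unfolding cinner_self[symmetric]
    by (simp add: cinner_add_left cinner_add_right flip: cinner_commute[of y x])
  then have "Re (complex_of_real ((norm (x + y))\<^sup>2))
      = Re (of_real ((norm x)\<^sup>2) + (cinner x y + cnj (cinner x y)) + of_real ((norm y)\<^sup>2))"
    by (rule arg_cong)
  then show ?thesis
    by (simp del: of_real_power)
qed

lemma norm_scaleC: "norm (c *\<^sub>C x) = cmod c * norm (x::'a::complex_inner)"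
proof -
  have "complex_of_real ((norm (c *\<^sub>C x))\<^sup>2) = of_real ((cmod c * norm x)\<^sup>2)"
    unfolding cinner_self[symmetric] cinner_scaleC_left cinner_scaleC_right
    unfolding power_mult_distrib of_real_mult complex_norm_square cinner_self by (simp add: mult_ac)
  then show ?thesis
    by (metis norm_ge_zero mult_nonneg_nonneg of_real_eq_iff power2_eq_imp_eq)
qed

text \<open>The triangle inequality comes with the norm of the class. Squaring it and cancelling the
  two squares leaves exactly this real form of Cauchy-Schwarz.\<close>

lemma Re_cinner_le_norm: "Re (cinner x y) \<le> norm x * norm (y::'a::complex_inner)"
proof -
  have "(norm (x + y))\<^sup>2 \<le> (norm x + norm y)\<^sup>2"
    by (intro power_mono norm_triangle_ineq) simp
  then show ?thesis
    by (simp add: norm_add_sq power2_sum)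
qed

text \<open>Multiplying \<open>x\<close> by a unimodular \<open>c\<close> keeps its norm and makes
  the inner product real and nonnegative, so the bound on the real part suffices.\<close>

lemma cmod_cinner_le_norm: "cmod (cinner x y) \<le> norm x * norm (y::'a::complex_inner)"
proof (cases "cinner x y = 0")
  case True
  then show ?thesis by simp
next
  case False
  define c where "c = of_real (cmod (cinner x y)) / cinner x y"
  have c: "cmod c = 1" "c * cinner x y = of_real (cmod (cinner x y))"
    using False by (simp_all add: c_def norm_divide)
  have "cmod (cinner x y) = Re (cinner (c *\<^sub>C x) y)"
    by (simp only: cinner_scaleC_left c Re_complex_of_real)
  also have "\<dots> \<le> norm (c *\<^sub>C x) * norm y"
    by (rule Re_cinner_le_norm)
  finally show ?thesis
    by (simp only: norm_scaleC c mult_1)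
qed

section \<open>Riesz representation and the adjoint\<close>

lemma cinner_right_cancel:
  fixes y z :: "'a::complex_inner"
  assumes "\<And>x. cinner x y = cinner x z"
  shows "y = z"
proof -
  have "cinner (y - z) (y - z) = 0"
    using assms by (simp add: cinner_diff_right)
  then show ?thesis
    by (simp add: cinner_self)
qed

text \<open>
  The representing vector is the minimiser of \<open>\<parallel>x\<parallel>\<^sup>2 - 2 Re (F x)\<close>: the parallelogram law makes
  minimising sequences Cauchy, and the first variation at the minimiser vanishes.
\<close>

lemma riesz_representation:
  fixes F :: "'a::complex_hilbert_space \<Rightarrow> complex"
  assumes F: "bounded_linear F" and FC: "\<And>c x. F (c *\<^sub>C x) = c * F x"
  obtains z where "\<And>x. F x = cinner x z"
proof -
  interpret F: bounded_linear F by (rule F)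
  define J where "J x = (norm x)\<^sup>2 - 2 * Re (F x)" for x
  obtain K where K: "\<And>x. norm (F x) \<le> norm x * K"
    using F.bounded by blast
  have "- K\<^sup>2 \<le> J x" for x
  proof -
    \<comment> \<open>Completing the square: \<open>J x\<close> is at least
      \<open>(norm x - K)\<^sup>2 - K\<^sup>2\<close>.\<close>
    have "Re (F x) \<le> norm x * K"
      using K[of x] complex_Re_le_cmod[of "F x"] by linarith
    moreover have "0 \<le> (norm x - K)\<^sup>2" by simp
    ultimately show ?thesis
      unfolding J_def power2_diff by linarith
  qed
  then have bdd: "bdd_below (range J)" by (auto simp: bdd_below_def)
  define d where "d = Inf (range J)"
  have d_le: "d \<le> J x" for x
    unfolding d_def by (rule cInf_lower[OF _ bdd]) simp
  have J_add: "J (x + y) = J x + 2 * Re (cinner x y) + J y" for x y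
    by (simp add: J_def norm_add_sq F.add)
  have J_scaleR: "J (r *\<^sub>R x) = r\<^sup>2 * (norm x)\<^sup>2 - 2 * r * Re (F x)" for r x
    by (simp add: J_def F.scaleR power_mult_distrib)
  have parallelogram: "(norm (x - y))\<^sup>2 \<le> 2 * J x + 2 * J y - 4 * d" for x y
  proof -
    \<comment> \<open>The midpoint of \<open>x\<close> and \<open>y\<close> competes with the
      infimum \<open>d\<close>.\<close>
    have "J ((1/2) *\<^sub>R x + (1/2) *\<^sub>R y)
        = ((norm x)\<^sup>2 + 2 * Re (cinner x y) + (norm y)\<^sup>2) / 4 - Re (F x) - Re (F y)"
      unfolding J_add J_scaleR
      by (simp add: cinner_scaleR_left cinner_scaleR_right field_simps power2_eq_square)
    then have "d \<le> ((norm x)\<^sup>2 + 2 * Re (cinner x y) + (norm y)\<^sup>2) / 4 - Re (F x) - Re (F y)"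
      using d_le by metis
    then have "4 * d \<le> (norm x)\<^sup>2 + 2 * Re (cinner x y) + (norm y)\<^sup>2 - 4 * Re (F x) - 4 * Re (F y)"
      by (simp add: field_simps)
    \<comment> \<open>The second instance of \<open>cinner_diff_right\<close> yields
      \<open>cinner x 0 = 0\<close>; the first then moves the sign out of
      \<open>cinner x (- y)\<close>.\<close>
    moreover have "(norm (x - y))\<^sup>2 = (norm x)\<^sup>2 - 2 * Re (cinner x y) + (norm y)\<^sup>2"
      using norm_add_sq[of x "- y"] cinner_diff_right[of x 0 y] cinner_diff_right[of x 0 0] by simp
    ultimately show ?thesis
      unfolding J_def by (simp add: algebra_simps)
  qed
  have "\<exists>x. J x < d + inverse (real (Suc n))" for n
  proof -
    have "Inf (range J) < d + inverse (real (Suc n))" unfolding d_def by simp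
    then show ?thesis
      using cInf_lessD[of "range J"] by auto
  qed
  then obtain X where X: "\<And>n. J (X n) < d + inverse (real (Suc n))"
    by metis
  have "Cauchy X"
  proof (rule CauchyI)
    fix e :: real assume "0 < e"
    then have "0 < e\<^sup>2 / 4" by simp
    then obtain N where N: "inverse (real (Suc N)) < e\<^sup>2 / 4"
      using reals_Archimedean by blast
    show "\<exists>M. \<forall>m\<ge>M. \<forall>n\<ge>M. norm (X m - X n) < e"
    proof (intro exI allI impI)
      fix m n assume mn: "N \<le> m" "N \<le> n"
      have "J (X k) < d + e\<^sup>2 / 4" if "N \<le> k" for k
      proof -
        have "inverse (real (Suc k)) \<le> inverse (real (Suc N))"
          using that by (intro le_imp_inverse_le) auto
        then show ?thesis using X[of k] N by linarith
      qed
      from this[OF mn(1)] this[OF mn(2)] have "(norm (X m - X n))\<^sup>2 < e\<^sup>2"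
        using parallelogram[of "X m" "X n"] by linarith
      then show "norm (X m - X n) < e"
        using \<open>0 < e\<close> by (meson less_imp_le power2_less_imp_less)
    qed
  qed
  then obtain z where z: "X \<longlonglongrightarrow> z"
    using Cauchy_convergent convergent_def by blast
  have "(\<lambda>n. J (X n)) \<longlonglongrightarrow> J z"
    unfolding J_def by (intro tendsto_intros F.tendsto z)
  moreover have "(\<lambda>n. d + inverse (real (Suc n))) \<longlonglongrightarrow> d + 0"
    by (intro tendsto_intros LIMSEQ_inverse_real_of_nat)
  ultimately have "J z \<le> d + 0"
    by (rule LIMSEQ_le) (use X less_imp_le in blast)
  then have z_min: "J z \<le> J x" for x
    using d_le[of x] by simp
  have re: "Re (F x) = Re (cinner x z)" for x
  proof (rule ccontr)
    define b where "b = Re (cinner x z) - Re (F x)"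
    assume "Re (F x) \<noteq> Re (cinner x z)"
    then have "b \<noteq> 0" by (simp add: b_def)
    have q: "0 \<le> r\<^sup>2 * (norm x)\<^sup>2 + 2 * r * b" for r
    proof -
      have "Re (cinner z x) = Re (cinner x z)"
        using arg_cong[OF cinner_commute[of z x], of Re] by simp
      then show ?thesis
        using z_min[of "z + r *\<^sub>R x"]
        by (simp add: J_add J_scaleR cinner_scaleR_right b_def algebra_simps)
    qed
    \<comment> \<open>The exact minimiser of the quadratic in \<open>q\<close> would have
      denominator \<open>(norm x)\<^sup>2\<close>. Adding 1 covers \<open>x = 0\<close> and still
      gives the negative value \<open>- (r\<^sup>2 * ((norm x)\<^sup>2 + 2))\<close>.\<close>
    define r where "r = - b / ((norm x)\<^sup>2 + 1)"
    have pos: "(norm x)\<^sup>2 + 1 > 0"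
      by (simp add: add_nonneg_pos)
    have b: "b = - r * ((norm x)\<^sup>2 + 1)"
      using pos by (simp add: r_def)
    have "r \<noteq> 0" using b \<open>b \<noteq> 0\<close> by auto
    have "0 \<le> - (r\<^sup>2 * ((norm x)\<^sup>2 + 2))"
      using q[of r] unfolding b by (simp add: algebra_simps power2_eq_square)
    moreover have "r\<^sup>2 * ((norm x)\<^sup>2 + 2) > 0"
      using \<open>r \<noteq> 0\<close> by (simp add: add_nonneg_pos)
    ultimately show False by linarith
  qed
  have "F x = cinner x z" for x
  proof (rule complex_eqI)
    \<comment> \<open>Both sides are complex linear in \<open>x\<close>, and the real part at
      \<open>\<i> *\<^sub>C x\<close> is minus the imaginary part at \<open>x\<close>.\<close>
    show "Im (F x) = Im (cinner x z)"
      using re[of "\<i> *\<^sub>C x"] by (simp add: FC cinner_scaleC_left)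
  qed (rule re)
  then show ?thesis by (rule that)
qed

text \<open>For each fixed \<open>y\<close>, Riesz represents the functional sending
  \<open>x\<close> to \<open>cinner (A x) y\<close>. The representing vectors form an operator
  \<open>B\<close>, unique by \<open>cinner_right_cancel\<close>, so the definite description is
  met.\<close>

lemma cinner_cadjoint:
  fixes A :: "'a::complex_hilbert_space \<Rightarrow> 'a"
  assumes A: "bounded_clinear A"
  shows "cinner (A x) y = cinner x (cadjoint A y)"
proof -
  interpret A: bounded_linear A using A by (simp add: bounded_clinear_def)
  obtain K where K: "\<And>x. norm (A x) \<le> norm x * K"
    using A.bounded by blast
  have "\<exists>z. \<forall>x. cinner (A x) y = cinner x z" for y
  proof -
    have bl: "bounded_linear (\<lambda>x. cinner (A x) y)"
    proof (rule bounded_linear_intro)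
      show "norm (cinner (A x) y) \<le> norm x * (K * norm y)" for x
        using cmod_cinner_le_norm[of "A x" y] mult_right_mono[OF K[of x] norm_ge_zero[of y]]
        by (simp add: mult.assoc)
    qed (simp_all add: A.add A.scaleR cinner_add_left cinner_scaleR_left scaleR_conv_of_real)
    have hom: "cinner (A (c *\<^sub>C x)) y = c * cinner (A x) y" for c x
      using A by (simp add: bounded_clinear_def cinner_scaleC_left)
    show ?thesis
      by (rule riesz_representation[OF bl hom]) auto
  qed
  then obtain B where B: "\<forall>x y. cinner (A x) y = cinner x (B y)"
    by metis
  have "\<forall>x y. cinner (A x) y = cinner x (cadjoint A y)"
    unfolding cadjoint_def
  proof (rule theI[where P = "\<lambda>B. \<forall>x y. cinner (A x) y = cinner x (B y)", OF B])
    fix C assume C: "\<forall>x y. cinner (A x) y = cinner x (C y)"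
    have "C y = B y" for y
      by (rule cinner_right_cancel) (metis B C)
    then show "C = B" by (rule ext)
  qed
  then show ?thesis by blast
qed

text \<open>Linearity is checked by pairing with arbitrary vectors. For the bound, the squared norm
  of \<open>cadjoint A x\<close> equals \<open>cinner (A (cadjoint A x)) x\<close>; Cauchy-Schwarz
  then allows one factor to be cancelled unless it is zero.\<close>

lemma bounded_linear_cadjoint:
  fixes A :: "'a::complex_hilbert_space \<Rightarrow> 'a"
  assumes A: "bounded_clinear A"
  shows "bounded_linear (cadjoint A)"
proof -
  interpret A: bounded_linear A using A by (simp add: bounded_clinear_def)
  obtain K where K: "K \<ge> 0" "\<And>x. norm (A x) \<le> norm x * K"
    using A.nonneg_bounded by blast
  note adj = cinner_cadjoint[OF A, symmetric]
  show ?thesis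
  proof (rule bounded_linear_intro)
    show "cadjoint A (x + y) = cadjoint A x + cadjoint A y" for x y
      by (rule cinner_right_cancel) (simp add: adj cinner_add_right)
    show "cadjoint A (r *\<^sub>R x) = r *\<^sub>R cadjoint A x" for r x
      by (rule cinner_right_cancel) (simp add: adj cinner_scaleR_right)
    show "norm (cadjoint A x) \<le> norm x * K" for x
    proof -
      let ?n = "norm (cadjoint A x)"
      have "complex_of_real (?n\<^sup>2) = cinner (A (cadjoint A x)) x"
        by (metis adj cinner_self)
      then have "?n\<^sup>2 = cmod (cinner (A (cadjoint A x)) x)"
        by (metis norm_of_real abs_of_nonneg zero_le_power2)
      also have "\<dots> \<le> norm (A (cadjoint A x)) * norm x"
        by (rule cmod_cinner_le_norm)
      also have "\<dots> \<le> ?n * K * norm x"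
        by (intro mult_right_mono K) simp
      finally have "?n * ?n \<le> ?n * (norm x * K)"
        by (simp add: power2_eq_square mult_ac)
      then show ?thesis
        using K(1) by (cases "?n = 0") auto
    qed
  qed
qed

lemma cinner_cadjoint_self:
  assumes "bounded_clinear A"
  shows "cinner (cadjoint A x) x = cnj (cinner (A x) x)"
  by (metis assms cinner_cadjoint cinner_commute)

section \<open>The numerical radius and its weighted version\<close>

lemma bounded_linear_weighted:
  assumes "bounded_clinear A"
  shows "bounded_linear (\<lambda>x. r *\<^sub>R cadjoint A x + A x)"
  using assms bounded_linear_cadjoint[OF assms] unfolding bounded_clinear_def
  by (intro bounded_linear_add bounded_linear_const_scaleR) auto

lemma cmod_cinner_le_onorm:
  fixes T :: "'a::complex_inner \<Rightarrow> 'a"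
  assumes "bounded_linear T" "norm x = 1"
  shows "cmod (cinner (T x) x) \<le> onorm T"
  using cmod_cinner_le_norm[of "T x" x] onorm[OF assms(1), of x] assms(2) by simp

text \<open>Boundedness makes the real \<open>Sup\<close> in \<open>numerical_radius\<close> a
  genuine least upper bound; the operator norm serves as bound.\<close>

lemma bdd_above_numerical_range:
  fixes T :: "'a::complex_inner \<Rightarrow> 'a"
  assumes "bounded_linear T"
  shows "bdd_above (insert 0 {cmod (cinner (T x) x) | x. norm x = 1})"
  unfolding bdd_above_def
  by (rule exI[of _ "onorm T"])
    (use cmod_cinner_le_onorm[OF assms] onorm_pos_le[OF assms] in auto)

lemma cmod_cinner_le_numerical_radius:
  fixes T :: "'a::complex_inner \<Rightarrow> 'a"
  assumes "bounded_linear T" "norm x = 1"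
  shows "cmod (cinner (T x) x) \<le> numerical_radius T"
  unfolding numerical_radius_def
  by (rule cSup_upper[OF _ bdd_above_numerical_range]) (use assms in auto)

lemma numerical_radius_nonneg:
  fixes T :: "'a::complex_inner \<Rightarrow> 'a"
  assumes "bounded_linear T"
  shows "0 \<le> numerical_radius T"
  unfolding numerical_radius_def
  by (rule cSup_upper[OF _ bdd_above_numerical_range]) (use assms in auto)

text \<open>The premise \<open>0 \<le> b\<close> accounts for the \<open>0\<close> inserted under
  the supremum.\<close>

lemma numerical_radius_least:
  assumes "0 \<le> b" "\<And>x. norm x = 1 \<Longrightarrow> cmod (cinner (T x) x) \<le> b"
  shows "numerical_radius T \<le> b"
  unfolding numerical_radius_def by (rule cSup_least) (use assms in auto)

lemma convex_weighted_numerical_radius: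
  assumes A: "bounded_clinear A"
  shows "convex_on UNIV (\<lambda>t. weighted_numerical_radius t A)"
proof (rule convex_onI)
  fix u s t :: real
  assume u: "0 < u" "u < 1"
  let ?T = "\<lambda>t x. (1 - 2 * t) *\<^sub>R cadjoint A x + A x"
  note bl = bounded_linear_weighted[OF A]
  show "weighted_numerical_radius ((1 - u) *\<^sub>R s + u *\<^sub>R t) A
      \<le> (1 - u) * weighted_numerical_radius s A + u * weighted_numerical_radius t A"
    unfolding weighted_numerical_radius_def
  proof (rule numerical_radius_least)
    show "0 \<le> (1 - u) * numerical_radius (?T s) + u * numerical_radius (?T t)"
      using u by (intro add_nonneg_nonneg mult_nonneg_nonneg numerical_radius_nonneg bl) auto
    fix x :: 'a assume x: "norm x = 1"
    \<comment> \<open>The coefficient \<open>1 - 2 * t\<close> is affine in \<open>t\<close>, and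
      the weights \<open>1 - u\<close> and \<open>u\<close> sum to 1, which reproduces the constant
      term \<open>A x\<close>.\<close>
    have "cinner (?T ((1 - u) *\<^sub>R s + u *\<^sub>R t) x) x
        = of_real (1 - u) * cinner (?T s x) x + of_real u * cinner (?T t x) x"
      unfolding cinner_add_left cinner_scaleR_left by (simp add: algebra_simps)
    then have "cmod (cinner (?T ((1 - u) *\<^sub>R s + u *\<^sub>R t) x) x)
        \<le> cmod (of_real (1 - u) * cinner (?T s x) x) + cmod (of_real u * cinner (?T t x) x)"
      by (simp only: norm_triangle_ineq)
    also have "\<dots> = (1 - u) * cmod (cinner (?T s x) x) + u * cmod (cinner (?T t x) x)"
      using u unfolding norm_mult norm_of_real by simp
    also have "\<dots> \<le> (1 - u) * numerical_radius (?T s) + u * numerical_radius (?T t)"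
      using u by (intro add_mono mult_left_mono cmod_cinner_le_numerical_radius bl x) auto
    finally show "cmod (cinner (?T ((1 - u) *\<^sub>R s + u *\<^sub>R t) x) x)
        \<le> (1 - u) * numerical_radius (?T s) + u * numerical_radius (?T t)" .
  qed
qed simp

lemma weighted_numerical_radius_0_le:
  assumes A: "bounded_clinear A"
  shows "weighted_numerical_radius 0 A \<le> 2 * onorm (re_part A)"
proof -
  \<comment> \<open>The factor \<open>1 *\<^sub>R\<close> stays so that the operator is the instance
    \<open>r = 1\<close> of \<open>bounded_linear_weighted\<close>.\<close>
  have re: "re_part A = (\<lambda>x. (1 / 2) *\<^sub>R (1 *\<^sub>R cadjoint A x + A x))"
    using scaleC_of_real[of "1 / 2", where ?'a = 'a] by (simp add: re_part_def add.commute)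
  have bl: "bounded_linear (re_part A)"
    unfolding re using bounded_linear_weighted[OF A]
    by (rule bounded_linear_const_scaleR)
  show ?thesis
    unfolding weighted_numerical_radius_def
  proof (rule numerical_radius_least)
    show "0 \<le> 2 * onorm (re_part A)" using onorm_pos_le[OF bl] by simp
    fix x :: 'a assume x: "norm x = 1"
    have "cinner ((1 - 2 * 0) *\<^sub>R cadjoint A x + A x) x = 2 * cinner (re_part A x) x"
      by (simp add: re cinner_scaleR_left)
    then show "cmod (cinner ((1 - 2 * 0) *\<^sub>R cadjoint A x + A x) x) \<le> 2 * onorm (re_part A)"
      using cmod_cinner_le_onorm[OF bl x] by (simp add: norm_mult)
  qed
qed

text \<open>Needed for \<open>im_part\<close>, whose factor \<open>1 / (2 * \<i>)\<close> is not a
  real scalar.\<close>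

lemma bounded_linear_scaleC: "bounded_linear (\<lambda>x::'a::complex_inner. c *\<^sub>C x)"
proof (rule bounded_linear_intro)
  show "norm (c *\<^sub>C x) \<le> norm x * cmod c" for x :: 'a
    by (simp add: norm_scaleC)
  show "c *\<^sub>C r *\<^sub>R x = r *\<^sub>R c *\<^sub>C x" for r and x :: 'a
    by (simp add: scaleC_scaleC mult.commute flip: scaleC_of_real)
qed (simp add: scaleC_add_right)

lemma weighted_numerical_radius_1_le:
  assumes A: "bounded_clinear A"
  shows "weighted_numerical_radius 1 A \<le> 2 * onorm (im_part A)"
proof -
  have im: "im_part A = (\<lambda>x. (1 / (2 * \<i>)) *\<^sub>C ((-1) *\<^sub>R cadjoint A x + A x))"
    by (simp add: im_part_def)
  have bl: "bounded_linear (im_part A)"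
    unfolding im
    by (rule bounded_linear_compose[OF bounded_linear_scaleC bounded_linear_weighted[OF A]])
  show ?thesis
    unfolding weighted_numerical_radius_def
  proof (rule numerical_radius_least)
    show "0 \<le> 2 * onorm (im_part A)" using onorm_pos_le[OF bl] by simp
    fix x :: 'a assume x: "norm x = 1"
    have "cinner ((1 - 2 * 1) *\<^sub>R cadjoint A x + A x) x = (2 * \<i>) * cinner (im_part A x) x"
      by (simp add: im cinner_scaleC_left)
    then show "cmod (cinner ((1 - 2 * 1) *\<^sub>R cadjoint A x + A x) x) \<le> 2 * onorm (im_part A)"
      using cmod_cinner_le_onorm[OF bl x] by (simp add: norm_mult)
  qed
qed

lemma weighted_numerical_radius_half: "weighted_numerical_radius (1 / 2) A = numerical_radius A"
  by (simp add: weighted_numerical_radius_def)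

section \<open>The Hermite-Hadamard inequalities\<close>

text \<open>Pair \<open>x\<close> with its reflection \<open>a + b - x\<close>. The sum of the two
  values of \<open>f\<close> has twice the integral of \<open>f\<close>, and by convexity it lies
  between \<open>2 * f ((a + b) / 2)\<close> and \<open>f a + f b\<close>. Multiplying by
  \<open>b - a\<close> instead of dividing admits \<open>a = b\<close>, which occurs for
  \<open>l = 0\<close> and \<open>l = 1\<close>.\<close>

lemma hermite_hadamard:
  fixes f :: "real \<Rightarrow> real"
  assumes f: "convex_on {a..b} f" and int: "f integrable_on {a..b}" and ab: "a \<le> b"
  shows "(b - a) * f ((a + b) / 2) \<le> integral {a..b} f"
    and "integral {a..b} f \<le> (b - a) * ((f a + f b) / 2)"
proof -
  have "(f has_integral integral {a..b} f) (cbox a b)"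
    using int by (simp add: integrable_integral)
  from has_integral_affinity[OF this, of "-1" "a + b"]
  have refl: "((\<lambda>x. f (a + b - x)) has_integral integral {a..b} f) {a..b}"
    using ab by (simp add: algebra_simps)
  have sum: "((\<lambda>x. f x + f (a + b - x)) has_integral 2 * integral {a..b} f) {a..b}"
    using has_integral_add[OF integrable_integral[OF int] refl] by simp
  have const: "((\<lambda>x. c) has_integral (b - a) * c) {a..b}" for c :: real
    using has_integral_const_real[of c a b] ab by simp
  have "(b - a) * (2 * f ((a + b) / 2)) \<le> 2 * integral {a..b} f"
  proof (rule has_integral_le[OF const sum])
    fix x assume x: "x \<in> {a..b}"
    have "f ((1 - 1 / 2) *\<^sub>R x + (1 / 2) *\<^sub>R (a + b - x))
        \<le> (1 - 1 / 2) * f x + 1 / 2 * f (a + b - x)"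
      using x by (intro convex_onD[OF f]) auto
    moreover have "(1 - 1 / 2) *\<^sub>R x + (1 / 2) *\<^sub>R (a + b - x) = (a + b) / 2"
      by (simp add: field_simps)
    ultimately have "f ((a + b) / 2) \<le> (1 - 1 / 2) * f x + 1 / 2 * f (a + b - x)"
      by metis
    then show "2 * f ((a + b) / 2) \<le> f x + f (a + b - x)"
      by simp
  qed
  then show "(b - a) * f ((a + b) / 2) \<le> integral {a..b} f"
    by simp
  have "2 * integral {a..b} f \<le> (b - a) * (f a + f b)"
  proof (rule has_integral_le[OF sum const])
    fix x assume x: "x \<in> {a..b}"
    show "f x + f (a + b - x) \<le> f a + f b"
    proof (cases "a = b")
      case True
      then show ?thesis using x by simp
    next
      case False
      define u where "u = (x - a) / (b - a)"
      have "a < b" using False ab by simp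
      then have u: "0 \<le> u" "u \<le> 1" and ux: "u * (b - a) = x - a"
        using x by (auto simp: u_def)
      \<comment> \<open>The reflection swaps the weights of the endpoints, so the two convexity
        bounds add up to \<open>f a + f b\<close>.\<close>
      have x_eq: "x = (1 - u) *\<^sub>R a + u *\<^sub>R b" "a + b - x = (1 - u) *\<^sub>R b + u *\<^sub>R a"
        using ux by (simp_all add: algebra_simps)
      have "f x \<le> (1 - u) * f a + u * f b" "f (a + b - x) \<le> (1 - u) * f b + u * f a"
        using ab u by (subst x_eq, intro convex_onD[OF f]; simp)+
      then show ?thesis by (simp add: algebra_simps)
    qed
  qed
  then show "integral {a..b} f \<le> (b - a) * ((f a + f b) / 2)"
    by simp
qed

section \<open>The chain of four inequalities\<close>

theorem corollary2p3:
  fixes A :: "'a::complex_hilbert_space \<Rightarrow> 'a" and l :: real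
  assumes "bounded_clinear A" and "0 \<le> l" and "l \<le> 1"
  shows "numerical_radius A
           \<le> l * weighted_numerical_radius (l / 2) A
             + (1 - l) * weighted_numerical_radius ((1 + l) / 2) A
       \<and> l * weighted_numerical_radius (l / 2) A
             + (1 - l) * weighted_numerical_radius ((1 + l) / 2) A
           \<le> integral {0..1} (\<lambda>t. weighted_numerical_radius t A)
       \<and> integral {0..1} (\<lambda>t. weighted_numerical_radius t A)
           \<le> 1 / 2 * weighted_numerical_radius l A
             + l * onorm (re_part A) + (1 - l) * onorm (im_part A)
       \<and> 1 / 2 * weighted_numerical_radius l A
             + l * onorm (re_part A) + (1 - l) * onorm (im_part A)
           \<le> onorm (re_part A) + onorm (im_part A)"
proof -
  define f where "f t = weighted_numerical_radius t A" for t
  have conv: "convex_on UNIV f"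
    using convex_weighted_numerical_radius[OF assms(1)] by (simp add: f_def[abs_def])
  \<comment> \<open>Convexity on the whole line, beyond the interval from 0 to 1, gives continuity
    at the endpoints too, and hence integrability.\<close>
  have "continuous_on UNIV f"
    by (rule convex_on_continuous[OF open_UNIV conv])
  then have int: "f integrable_on {a..b}" for a b
    by (intro integrable_continuous_interval) (rule continuous_on_subset, auto)
  have conv': "convex_on {a..b} f" for a b
    by (rule convex_on_subset[OF conv]) auto
  \<comment> \<open>The weights are written as \<open>1 - u\<close> and \<open>u\<close> with
    \<open>u = 1 - l\<close>, the form \<open>convex_onD\<close> expects.\<close>
  have "1 / 2 = (1 - (1 - l)) *\<^sub>R (l / 2) + (1 - l) *\<^sub>R ((1 + l) / 2)"
    by (simp add: field_simps)
  then have "f (1 / 2) = f ((1 - (1 - l)) *\<^sub>R (l / 2) + (1 - l) *\<^sub>R ((1 + l) / 2))"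
    by (rule arg_cong)
  also have "\<dots> \<le> (1 - (1 - l)) * f (l / 2) + (1 - l) * f ((1 + l) / 2)"
    using assms by (intro convex_onD[OF conv]) auto
  finally have "f (1 / 2) \<le> l * f (l / 2) + (1 - l) * f ((1 + l) / 2)"
    by simp
  then have first: "numerical_radius A \<le> l * f (l / 2) + (1 - l) * f ((1 + l) / 2)"
    by (simp add: f_def weighted_numerical_radius_half)
  have split: "integral {0..1} f = integral {0..l} f + integral {l..1} f"
    using Henstock_Kurzweil_Integration.integral_combine[OF assms(2,3) int] by simp
  \<comment> \<open>The subintervals have lengths \<open>l\<close> and \<open>1 - l\<close> and
    midpoints \<open>l / 2\<close> and \<open>(1 + l) / 2\<close>.\<close>
  have second: "l * f (l / 2) + (1 - l) * f ((1 + l) / 2) \<le> integral {0..1} f"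
    using hermite_hadamard(1)[OF conv' int, of 0 l] hermite_hadamard(1)[OF conv' int, of l 1] assms
    by (simp add: split add.commute[of l])
  have f0: "f 0 \<le> 2 * onorm (re_part A)" and f1: "f 1 \<le> 2 * onorm (im_part A)"
    using weighted_numerical_radius_0_le[OF assms(1)] weighted_numerical_radius_1_le[OF assms(1)]
    by (simp_all add: f_def)
  have "integral {0..1} f \<le> l * ((f 0 + f l) / 2) + (1 - l) * ((f l + f 1) / 2)"
    using hermite_hadamard(2)[OF conv' int, of 0 l] hermite_hadamard(2)[OF conv' int, of l 1] assms
    by (simp add: split)
  \<comment> \<open>The endpoint \<open>l\<close> is shared by both trapezoids, so the weight of
    \<open>f l\<close> is half the total length 1.\<close>
  also have "\<dots> = 1 / 2 * f l + l * (f 0 / 2) + (1 - l) * (f 1 / 2)"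
    by (simp add: field_simps)
  also have "\<dots> \<le> 1 / 2 * f l + l * onorm (re_part A) + (1 - l) * onorm (im_part A)"
    using f0 f1 assms by (intro add_mono mult_left_mono) auto
  finally have third: "integral {0..1} f
      \<le> 1 / 2 * f l + l * onorm (re_part A) + (1 - l) * onorm (im_part A)" .
  \<comment> \<open>Here the weights are crossed: half of this bound puts \<open>1 - l\<close> on
    the real part and \<open>l\<close> on the imaginary part, completing the weights
    \<open>l\<close> and \<open>1 - l\<close> to 1.\<close>
  have "f l \<le> (1 - l) * f 0 + l * f 1"
    using convex_onD[OF conv, of l 0 1] assms by simp
  also have "\<dots> \<le> (1 - l) * (2 * onorm (re_part A)) + l * (2 * onorm (im_part A))"
    using f0 f1 assms by (intro add_mono mult_left_mono) auto
  finally have "1 / 2 * f l + l * onorm (re_part A) + (1 - l) * onorm (im_part A)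
      \<le> onorm (re_part A) + onorm (im_part A)"
    by (simp add: algebra_simps)
  with first second third show ?thesis
    by (simp add: f_def[abs_def])
qed

end
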